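(* Let $s,d$ be integers, both at least $2$, and define integers $e_1,\dots,e_s,v,k$ by $$e_1=d+1,\qquad e_i=d+\prod_{j=1}^{i-1}e_j\ \ (2\le i\le s),\qquad v=\prod_{j=1}^s e_j,\qquad k=1+\frac{v-1}{d}.$$ Let $\mathscr{P}=\prod_{i=1}^s\mathbb{Z}_{e_i}$, and let $G=S_{e_1}\wr\cdots\wr S_{e_s}$ be the stabiliser in $\mathrm{Sym}(\mathscr{P})$ of the chain of partitions $\mathscr{C}_0\prec\cdots\prec\mathscr{C}_s$ described in the context. Let $y_0=1$ and $y_i=1+\frac{k-1}{v-1}\left(\left(\prod_{j=1}^i e_j\right)-1\right)$ for $1\le i\le s$, let $$B=\left\{(\delta_1,\dots,\delta_s)\in\mathscr{P} : 0\le\delta_i\le\frac{y_i}{y_{i-1}}-1\text{ for }1\le i\le s\right\},$$ and let $\mathscr{D}=(\mathscr{P},B^G)$, where $B^G=\{B^g: g\in G\}$. Then $\mathscr{D}$ is a $G$-flag-transitive, $(G,s)$-chain-imprimitive $2$-$(v,k,\lambda)$ design with $\lambda=\frac{bk}{vd}$, where $b=\prod_{i=1}^s\binom{e_i}{y_i/y_{i-1}}^{k/y_i}$, and $y_i=\frac{e_{i+1}-1}{d}$ for all $i\in\{1,\dots,s-1\}$, and $y_s=k$.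
   Context: $\mathbb{Z}_e=\{0,1,\dots,e-1\}$. For $0\le i\le s$, $\mathscr{C}_i$ is the partition of $\mathscr{P}=\prod_{i=1}^s\mathbb{Z}_{e_i}$ in which two points lie in the same class iff their $j$-th coordinates agree for all $j>i$; so $\mathscr{C}_0$ is the partition into singletons, $\mathscr{C}_s=\{\mathscr{P}\}$, and each $\mathscr{C}_i$-class is a union of $e_i$ $\mathscr{C}_{i-1}$-classes. $S_{e_1}\wr\cdots\wr S_{e_s}$ (iterated wreath product) denotes the group of all permutations of $\mathscr{P}$ leaving invariant each of the partitions $\mathscr{C}_0,\dots,\mathscr{C}_s$. A $2$-$(v,k,\lambda)$ design is a pair $(\mathscr{P},\mathscr{B})$ with $|\mathscr{P}|=v$, $\mathscr{B}$ a nonempty set of $k$-subsets of $\mathscr{P}$ (blocks), such that any two distinct points lie in exactly $\lambda$ blocks. It is $G$-flag-transitive if $G$ is a group of automorphisms transitive on the flags, i.e. pairs $(\delta,B)$ with $\delta\in B\in\mathscr{B}$. It is $(G,s)$-chain-imprimitive if $G$ is a group of automorphisms which is transitive on $\mathscr{P}$ and leaves invariant each partition of the chain $\mathscr{C}_0\prec\cdots\prec\mathscr{C}_s$. *)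

theory Defs
  imports Complex_Main "HOL-Algebra.Bij" "HOL-Library.Disjoint_Sets"
begin

text \<open>
  Permutations of a set \<open>P\<close> are the elements of \<^term>\<open>Bij P\<close>, i.e. functions that are
  undefined outside \<open>P\<close>, so that \<open>Sym(P)\<close> is \<^term>\<open>BijGroup P\<close>. The image \<open>X\<^sup>g\<close> of a set
  of points is \<open>g ` X\<close>.
\<close>

subsection \<open>Designs and their automorphism groups\<close>

definition two_design :: "'a set \<Rightarrow> 'a set set \<Rightarrow> nat \<Rightarrow> nat \<Rightarrow> nat \<Rightarrow> bool" where
  "two_design P \<B> v k l \<longleftrightarrow>
     finite P \<and> card P = v \<and>
     \<B> \<noteq> {} \<and> (\<forall>X\<in>\<B>. X \<subseteq> P \<and> card X = k) \<and>
     (\<forall>x\<in>P. \<forall>y\<in>P. x \<noteq> y \<longrightarrow> card {X \<in> \<B>. x \<in> X \<and> y \<in> X} = l)"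

definition automorphism_group :: "'a set \<Rightarrow> 'a set set \<Rightarrow> ('a \<Rightarrow> 'a) set \<Rightarrow> bool" where
  "automorphism_group P \<B> G \<longleftrightarrow>
     subgroup G (BijGroup P) \<and> (\<forall>g\<in>G. (\<lambda>X. g ` X) ` \<B> = \<B>)"

definition flag_transitive :: "'a set \<Rightarrow> 'a set set \<Rightarrow> ('a \<Rightarrow> 'a) set \<Rightarrow> bool" where
  "flag_transitive P \<B> G \<longleftrightarrow>
     automorphism_group P \<B> G \<and>
     (\<forall>X\<in>\<B>. \<forall>x\<in>X. \<forall>Y\<in>\<B>. \<forall>y\<in>Y. \<exists>g\<in>G. g x = y \<and> g ` X = Y)"

subsection \<open>Chains of partitions\<close>

definition partition_chain :: "'a set \<Rightarrow> nat \<Rightarrow> (nat \<Rightarrow> 'a set set) \<Rightarrow> bool" where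
  "partition_chain P s C \<longleftrightarrow>
     C 0 = (\<lambda>x. {x}) ` P \<and> C s = {P} \<and>
     (\<forall>i<s. refines P (C i) (C (Suc i)) \<and> C i \<noteq> C (Suc i))"

definition leaves_invariant :: "('a \<Rightarrow> 'a) \<Rightarrow> 'a set set \<Rightarrow> bool" where
  "leaves_invariant g \<C> \<longleftrightarrow> (\<lambda>X. g ` X) ` \<C> = \<C>"

definition chain_imprimitive ::
  "'a set \<Rightarrow> 'a set set \<Rightarrow> ('a \<Rightarrow> 'a) set \<Rightarrow> nat \<Rightarrow> (nat \<Rightarrow> 'a set set) \<Rightarrow> bool" where
  "chain_imprimitive P \<B> G s C \<longleftrightarrow>
     automorphism_group P \<B> G \<and>
     (\<forall>x\<in>P. \<forall>y\<in>P. \<exists>g\<in>G. g x = y) \<and>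
     partition_chain P s C \<and>
     (\<forall>g\<in>G. \<forall>i\<le>s. leaves_invariant g (C i))"

definition chain_stabiliser :: "'a set \<Rightarrow> nat \<Rightarrow> (nat \<Rightarrow> 'a set set) \<Rightarrow> ('a \<Rightarrow> 'a) set" where
  "chain_stabiliser P s C = {g \<in> Bij P. \<forall>i\<le>s. leaves_invariant g (C i)}"

subsection \<open>The grid and its chain of partitions\<close>

text \<open>A point is a function \<open>\<delta>\<close> with coordinates \<open>\<delta> 1, \<dots>, \<delta> s\<close>, undefined at other indices.\<close>

definition grid :: "nat \<Rightarrow> (nat \<Rightarrow> nat) \<Rightarrow> (nat \<Rightarrow> nat) set" where
  "grid s e = (\<Pi>\<^sub>E i\<in>{1..s}. {..<e i})"

definition grid_partition :: "nat \<Rightarrow> (nat \<Rightarrow> nat) \<Rightarrow> nat \<Rightarrow> (nat \<Rightarrow> nat) set set" where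
  "grid_partition s e i =
     grid s e // {(x, y) \<in> grid s e \<times> grid s e. \<forall>j\<in>{i<..s}. x j = y j}"

definition wreath :: "nat \<Rightarrow> (nat \<Rightarrow> nat) \<Rightarrow> ((nat \<Rightarrow> nat) \<Rightarrow> nat \<Rightarrow> nat) set" where
  "wreath s e = chain_stabiliser (grid s e) s (grid_partition s e)"

definition block_orbit :: "('a \<Rightarrow> 'a) set \<Rightarrow> 'a set \<Rightarrow> 'a set set" where
  "block_orbit G X = (\<lambda>g. g ` X) ` G"

end

theory Submission
  imports Defs
begin

text \<open>
  Put \<open>E i = e 1 * \<dots> * e i\<close>. Then \<open>y i / y (i - 1) = x i\<close> with \<open>x i = E (i - 1) + 1\<close>, while
  \<open>e i - 1 = d * y (i - 1)\<close>, so \<open>B\<close> is itself a grid, with sides \<open>x i\<close>. Its orbit under the wreath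
  product consists of the sets that have \<open>x j\<close> children below each of their nodes at every level
  \<open>j\<close>; a permutation acting independently below every node moves any such set, together with
  a chosen point, to \<open>B\<close> and the zero point, which gives flag-transitivity. The orbits of the
  wreath product on pairs of distinct points are given by the level \<open>i\<close> at which a pair separates,
  and a double count for each level yields
  \<open>\<lambda> = (b k / v) * (x i - 1) y (i - 1) / ((e i - 1) E (i - 1)) = b k / (v d)\<close>, independently of \<open>i\<close>.
\<close>

subsection \<open>Chain stabilisers and orbits of blocks\<close>

lemma mult_BijGroup:
  "g \<in> Bij P \<Longrightarrow> f \<in> Bij P \<Longrightarrow> g \<otimes>\<^bsub>BijGroup P\<^esub> f = compose P g f"
  by (simp add: BijGroup_def)

lemma inv_BijGroup':
  assumes "g \<in> Bij P"
  shows "inv\<^bsub>BijGroup P\<^esub> g = (\<lambda>x\<in>P. inv_into P g x)"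
proof (rule group.inv_equality[OF group_BijGroup])
  show "(\<lambda>x\<in>P. inv_into P g x) \<otimes>\<^bsub>BijGroup P\<^esub> g = \<one>\<^bsub>BijGroup P\<^esub>"
    using assms restrict_inv_into_Bij[OF assms] Bij_compose_restrict_eq[OF assms]
    by (simp add: mult_BijGroup) (simp add: BijGroup_def)
qed (use assms restrict_inv_into_Bij[OF assms] in \<open>auto simp: BijGroup_def\<close>)

lemma image_compose_subset: "X \<subseteq> P \<Longrightarrow> compose P g f ` X = g ` f ` X"
  by (force simp: compose_def)

lemma image_restrict_inv_into:
  assumes "g \<in> Bij P" "X \<subseteq> P"
  shows "(\<lambda>x\<in>P. inv_into P g x) ` g ` X = X"
proof -
  have "compose P (\<lambda>x\<in>P. inv_into P g x) g ` X = X"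
    using assms by (subst Bij_compose_restrict_eq) auto
  then show ?thesis using assms by (simp add: image_compose_subset)
qed

text \<open>Each class has to lie in \<open>P\<close>: only there do \<open>compose P g h\<close>
  and the restricted inverse act as the true composition and inverse, so that images of classes can
  be composed and undone.\<close>

lemma subgroup_chain_stabiliser:
  assumes C: "\<And>i. i \<le> s \<Longrightarrow> \<Union>(C i) \<subseteq> P"
  shows "subgroup (chain_stabiliser P s C) (BijGroup P)"
proof (rule group.subgroupI[OF group_BijGroup])
  show "chain_stabiliser P s C \<subseteq> carrier (BijGroup P)"
    by (auto simp: chain_stabiliser_def BijGroup_def)
  have sub: "X \<subseteq> P" if "X \<in> C i" "i \<le> s" for X i
    using C that by blast
  have "(\<lambda>x\<in>P. x) ` X = X" if "X \<in> C i" "i \<le> s" for X i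
    using sub[OF that] by auto
  then have "(\<lambda>x\<in>P. x) \<in> chain_stabiliser P s C"
    by (auto simp: chain_stabiliser_def leaves_invariant_def id_Bij)
  then show "chain_stabiliser P s C \<noteq> {}" by blast
  fix g assume g: "g \<in> chain_stabiliser P s C"
  then have gB: "g \<in> Bij P" by (simp add: chain_stabiliser_def)
  have "leaves_invariant (\<lambda>x\<in>P. inv_into P g x) (C i)" if i: "i \<le> s" for i
  proof -
    have gC: "(\<lambda>X. g ` X) ` C i = C i"
      using g i by (simp add: chain_stabiliser_def leaves_invariant_def)
    have "(\<lambda>X. (\<lambda>x\<in>P. inv_into P g x) ` X) ` (\<lambda>X. g ` X) ` C i = (\<lambda>X. X) ` C i"
      unfolding image_image[of "\<lambda>X. (\<lambda>x\<in>P. inv_into P g x) ` X"]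
      by (rule image_cong[OF refl]) (use sub[OF _ i] gB in \<open>metis image_restrict_inv_into\<close>)
    then show ?thesis unfolding gC leaves_invariant_def by simp
  qed
  then show "inv\<^bsub>BijGroup P\<^esub> g \<in> chain_stabiliser P s C"
    using gB by (simp add: inv_BijGroup' chain_stabiliser_def restrict_inv_into_Bij)
  fix h assume h: "h \<in> chain_stabiliser P s C"
  then have hB: "h \<in> Bij P" by (simp add: chain_stabiliser_def)
  have "leaves_invariant (compose P g h) (C i)" if i: "i \<le> s" for i
  proof -
    have "(\<lambda>X. compose P g h ` X) ` C i = (\<lambda>X. g ` X) ` (\<lambda>X. h ` X) ` C i"
      unfolding image_image[of "\<lambda>X. g ` X"]
      by (rule image_cong[OF refl]) (use sub[OF _ i] in \<open>simp add: image_compose_subset\<close>)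
    then show ?thesis using g h i by (simp add: chain_stabiliser_def leaves_invariant_def)
  qed
  then show "g \<otimes>\<^bsub>BijGroup P\<^esub> h \<in> chain_stabiliser P s C"
    using gB hB by (simp add: mult_BijGroup chain_stabiliser_def compose_Bij)
qed

section \<open>Subgroups of Sym(P) acting on points and blocks\<close>

context
  fixes P :: "'a set" and G :: "('a \<Rightarrow> 'a) set"
  assumes G: "subgroup G (BijGroup P)"
begin

lemma subgroup_Bij: "g \<in> G \<Longrightarrow> g \<in> Bij P"
  using subgroup.subset[OF G] by (auto simp: BijGroup_def)

lemma subgroup_compose: "g \<in> G \<Longrightarrow> h \<in> G \<Longrightarrow> compose P g h \<in> G"
  using subgroup.m_closed[OF G, of g h] by (simp add: mult_BijGroup subgroup_Bij)

lemma subgroup_inverse: "g \<in> G \<Longrightarrow> (\<lambda>x\<in>P. inv_into P g x) \<in> G"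
  using subgroup.m_inv_closed[OF G, of g] by (simp add: inv_BijGroup' subgroup_Bij)

lemma subgroup_inverse_apply:
  "g \<in> G \<Longrightarrow> x \<in> P \<Longrightarrow> (\<lambda>x\<in>P. inv_into P g x) (g x) = x"
  using subgroup_Bij[of g] by (auto simp: Bij_def bij_betw_def)

lemma subgroup_apply_in: "g \<in> G \<Longrightarrow> x \<in> P \<Longrightarrow> g x \<in> P"
  using Bij_imp_funcset[OF subgroup_Bij] by blast

text \<open>The element is \<open>h\<close> inverse after \<open>g\<close>. Whenever
  \<open>g\<close> and \<open>h\<close> bring two configurations to the same standard position, it
  carries the first configuration to the second, points and sets at once.\<close>

lemma subgroup_connect:
  assumes g: "g \<in> G" and h: "h \<in> G"
  obtains f where "f \<in> G"
    and "\<And>x x'. x \<in> P \<Longrightarrow> x' \<in> P \<Longrightarrow> g x = h x' \<Longrightarrow> f x = x'"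
    and "\<And>X X'. X \<subseteq> P \<Longrightarrow> X' \<subseteq> P \<Longrightarrow> g ` X = h ` X' \<Longrightarrow> f ` X = X'"
proof
  let ?f = "compose P (\<lambda>x\<in>P. inv_into P h x) g"
  show "?f \<in> G" by (intro subgroup_compose subgroup_inverse g h)
  show "?f x = x'" if "x \<in> P" "x' \<in> P" "g x = h x'" for x x'
    using that subgroup_inverse_apply[OF h \<open>x' \<in> P\<close>] by (simp add: compose_eq)
  show "?f ` X = X'" if "X \<subseteq> P" "X' \<subseteq> P" "g ` X = h ` X'" for X X'
    using that image_restrict_inv_into[OF subgroup_Bij[OF h] \<open>X' \<subseteq> P\<close>]
    by (simp add: image_compose_subset)
qed

lemma automorphism_group_block_orbit:
  assumes B: "B \<subseteq> P"
  shows "automorphism_group P (block_orbit G B) G"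
  unfolding automorphism_group_def
proof (intro conjI ballI G)
  fix h assume h: "h \<in> G"
  show "(\<lambda>X. h ` X) ` block_orbit G B = block_orbit G B"
  proof (intro equalityI subsetI)
    fix X assume "X \<in> (\<lambda>X. h ` X) ` block_orbit G B"
    then obtain g where g: "g \<in> G" "X = h ` g ` B" by (auto simp: block_orbit_def)
    then have "X = compose P h g ` B" using B by (simp add: image_compose_subset)
    then show "X \<in> block_orbit G B"
      unfolding block_orbit_def using subgroup_compose[OF h g(1)] by blast
  next
    fix X assume "X \<in> block_orbit G B"
    then obtain g where g: "g \<in> G" "X = g ` B" by (auto simp: block_orbit_def)
    \<comment> \<open>Here \<open>f\<close> is \<open>h\<close> inverse after \<open>g\<close>, so
      \<open>h\<close> applied to the orbit member \<open>f\<close> B\<open>returns\<close>g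
      \<open>B\<close>.\<close>
    obtain f where f: "f \<in> G" "\<And>x x'. x \<in> P \<Longrightarrow> x' \<in> P \<Longrightarrow> g x = h x' \<Longrightarrow> f x = x'"
      using subgroup_connect[OF g(1) h] by metis
    have "h ` f ` B = g ` B"
    proof -
      have "h (f x) = g x" if x: "x \<in> P" for x
      proof -
        obtain x' where "x' \<in> P" "g x = h x'"
          using subgroup_Bij[OF h] subgroup_apply_in[OF g(1) x]
          by (metis Bij_def IntD2 bij_betw_def imageE mem_Collect_eq)
        then show ?thesis using f(2)[OF x] by metis
      qed
      then show ?thesis using B by (force simp: image_image)
    qed
    then show "X \<in> (\<lambda>X. h ` X) ` block_orbit G B"
      unfolding block_orbit_def g(2) using f(1) by (metis image_eqI)
  qed
qed

text \<open>Since \<open>g\<close> permutes the blocks and is injective on \<open>P\<close>, taking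
  images is a bijection from the blocks through \<open>x\<close> and \<open>y\<close> to those
  through \<open>g x\<close> and \<open>g y\<close>. The count is thus constant on orbits of
  pairs.\<close>

lemma card_blocks_through_image:
  assumes \<B>: "automorphism_group P \<B> G" "\<And>X. X \<in> \<B> \<Longrightarrow> X \<subseteq> P"
    and g: "g \<in> G" and xy: "x \<in> P" "y \<in> P"
  shows "card {X \<in> \<B>. g x \<in> X \<and> g y \<in> X} = card {X \<in> \<B>. x \<in> X \<and> y \<in> X}"
proof -
  have inj: "inj_on g P" using subgroup_Bij[OF g] by (auto simp: Bij_def bij_betw_def)
  have mem: "g z \<in> g ` X \<longleftrightarrow> z \<in> X" if "z \<in> P" "X \<in> \<B>" for z X
    using inj that \<B>(2) by (meson inj_on_image_mem_iff)
  have im: "(\<lambda>X. g ` X) ` \<B> = \<B>" using \<B>(1) g by (simp add: automorphism_group_def)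
  have "{X \<in> \<B>. g x \<in> X \<and> g y \<in> X} = (\<lambda>X. g ` X) ` {X \<in> \<B>. x \<in> X \<and> y \<in> X}"
  proof -
    have "{X \<in> \<B>. g x \<in> X \<and> g y \<in> X} = {X \<in> (\<lambda>X. g ` X) ` \<B>. g x \<in> X \<and> g y \<in> X}"
      using im by simp
    also have "\<dots> = (\<lambda>X. g ` X) ` {X \<in> \<B>. x \<in> X \<and> y \<in> X}"
      using mem xy by auto
    finally show ?thesis .
  qed
  moreover have "inj_on (\<lambda>X. g ` X) {X \<in> \<B>. x \<in> X \<and> y \<in> X}"
    using \<B>(2) inj by (intro inj_onI) (metis (lifting) inj_on_image_eq_iff mem_Collect_eq)
  ultimately show ?thesis by (simp add: card_image)
qed

end

text \<open>Invariance of the set of classes becomes a pointwise condition. If classes go to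
  classes, related points stay related; conversely the class of \<open>g x\<close> is the image of
  some class, and injectivity pulls \<open>x\<close> and \<open>y\<close> back into it.\<close>

lemma leaves_invariant_quotient_iff:
  assumes R: "equiv P R" and g: "bij_betw g P P"
  shows "leaves_invariant g (P // R) \<longleftrightarrow> (\<forall>x\<in>P. \<forall>y\<in>P. (g x, g y) \<in> R \<longleftrightarrow> (x, y) \<in> R)"
proof
  assume inv: "leaves_invariant g (P // R)"
  have inj: "inj_on g P" and gP: "g x \<in> P" if "x \<in> P" for x
    using g that by (auto simp: bij_betw_def)
  show "\<forall>x\<in>P. \<forall>y\<in>P. (g x, g y) \<in> R \<longleftrightarrow> (x, y) \<in> R"
  proof (intro ballI iffI)
    fix x y assume xy: "x \<in> P" "y \<in> P"
    {
      assume "(x, y) \<in> R"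
      then have "x \<in> R``{x}" "y \<in> R``{x}" using equiv_class_self[OF R] xy by auto
      moreover have "g ` (R``{x}) \<in> P // R"
        using inv xy(1) unfolding leaves_invariant_def by (metis imageI quotientI)
      ultimately show "(g x, g y) \<in> R"
        using quotient_eq_iff[OF R, of "g ` (R``{x})" "g ` (R``{x})" "g x" "g y"] by blast
    }
    assume gR: "(g x, g y) \<in> R"
    have "R``{g x} \<in> (\<lambda>X. g ` X) ` (P // R)"
      using inv gP[OF xy(1)] unfolding leaves_invariant_def by (simp add: quotientI)
    then obtain X where X: "X \<in> P // R" "R``{g x} = g ` X" by auto
    then have "X \<subseteq> P" using in_quotient_imp_subset[OF R] by blast
    moreover have "g x \<in> g ` X" "g y \<in> g ` X"
      using X(2) gR equiv_class_self[OF R gP[OF xy(1)]] by auto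
    ultimately have "x \<in> X" "y \<in> X"
      using inj xy by (metis inj_on_image_mem_iff)+
    then show "(x, y) \<in> R" using quotient_eq_iff[OF R X(1) X(1)] by blast
  qed
next
  assume *: "\<forall>x\<in>P. \<forall>y\<in>P. (g x, g y) \<in> R \<longleftrightarrow> (x, y) \<in> R"
  have gP: "g ` P = P" using g by (simp add: bij_betw_def)
  have cl: "g ` (R``{x}) = R``{g x}" if "x \<in> P" for x
  proof (intro equalityI subsetI)
    fix z assume "z \<in> R``{g x}"
    then have "(g x, z) \<in> R" "z \<in> g ` P" using equiv_type[OF R] gP by auto
    then show "z \<in> g ` (R``{x})" using * that by auto
  qed (use * that equiv_type[OF R] in auto)
  have "(\<lambda>X. g ` X) ` (P // R) = (\<lambda>x. g ` (R``{x})) ` P"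
    by (auto simp: quotient_def)
  also have "\<dots> = (\<lambda>x. R``{x}) ` g ` P"
    using cl by (simp add: image_image)
  also have "\<dots> = P // R" by (auto simp: gP quotient_def)
  finally show "leaves_invariant g (P // R)" by (simp add: leaves_invariant_def)
qed

subsection \<open>Tails and level maps\<close>

text \<open>The tail beyond \<open>i\<close> names the class of level \<open>i\<close> containing
  \<open>z\<close>, that is, a node of the rooted tree of nested classes: \<open>tail s s z\<close>
  is the root and \<open>tail s 0 z\<close> determines a grid point. Restriction makes equality of
  nodes plain equality of functions.\<close>

definition tail :: "nat \<Rightarrow> nat \<Rightarrow> (nat \<Rightarrow> nat) \<Rightarrow> nat \<Rightarrow> nat" where
  "tail s i z = restrict z {i<..s}"

lemma tail_eq_iff: "tail s i z = tail s i w \<longleftrightarrow> (\<forall>j\<in>{i<..s}. z j = w j)"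
  by (auto simp: tail_def fun_eq_iff restrict_def)

lemma tail_eq_mono: "i \<le> i' \<Longrightarrow> tail s i z = tail s i w \<Longrightarrow> tail s i' z = tail s i' w"
  by (auto simp: tail_eq_iff)

lemma tail_step_iff:
  assumes "n < s"
  shows "tail s n z = tail s n w \<longleftrightarrow> tail s (Suc n) z = tail s (Suc n) w \<and> z (Suc n) = w (Suc n)"
proof -
  have "{n<..s} = insert (Suc n) {Suc n<..s}" using assms by auto
  then show ?thesis by (auto simp: tail_eq_iff)
qed

lemma tail_pred_iff:
  "i \<in> {1..s} \<Longrightarrow> tail s (i - 1) z = tail s (i - 1) w \<longleftrightarrow> tail s i z = tail s i w \<and> z i = w i"
  using tail_step_iff[of "i - 1" s z w] by (cases i) auto

lemma grid_tail_0_eq: "z \<in> grid s e \<Longrightarrow> w \<in> grid s e \<Longrightarrow> tail s 0 z = tail s 0 w \<Longrightarrow> z = w"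
  unfolding grid_def tail_eq_iff by (rule PiE_ext) auto

definition level_relation :: "nat \<Rightarrow> (nat \<Rightarrow> nat) \<Rightarrow> nat \<Rightarrow> ((nat \<Rightarrow> nat) \<times> (nat \<Rightarrow> nat)) set" where
  "level_relation s e i = {(x, y) \<in> grid s e \<times> grid s e. tail s i x = tail s i y}"

lemma grid_partition_eq: "grid_partition s e i = grid s e // level_relation s e i"
  by (simp add: grid_partition_def level_relation_def tail_eq_iff)

lemma equiv_level_relation: "equiv (grid s e) (level_relation s e i)"
  by (intro equivI refl_onI symI transI) (auto simp: level_relation_def)

lemma grid_partition_sub: "\<Union>(grid_partition s e i) \<subseteq> grid s e"
  unfolding grid_partition_eq by (simp add: Union_quotient[OF equiv_level_relation])

lemma finite_grid: "finite (grid s e)"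
  unfolding grid_def by (rule finite_PiE) auto

lemma card_grid: "card (grid s e) = (\<Prod>j=1..s. e j)"
  unfolding grid_def by (simp add: card_PiE)

lemma grid_apply_less: "z \<in> grid s e \<Longrightarrow> j \<in> {1..s} \<Longrightarrow> z j < e j"
  by (auto simp: grid_def)

text \<open>This is the working form of the wreath product: its elements are the bijections of the
  grid that preserve and reflect equality of nodes at every level.\<close>

lemma wreath_iff:
  "g \<in> wreath s e \<longleftrightarrow> g \<in> Bij (grid s e) \<and>
     (\<forall>i\<le>s. \<forall>x\<in>grid s e. \<forall>y\<in>grid s e. tail s i (g x) = tail s i (g y) \<longleftrightarrow> tail s i x = tail s i y)"
proof -
  have "leaves_invariant g (grid_partition s e i) \<longleftrightarrow>
      (\<forall>x\<in>grid s e. \<forall>y\<in>grid s e. tail s i (g x) = tail s i (g y) \<longleftrightarrow> tail s i x = tail s i y)"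
    if g: "g \<in> Bij (grid s e)" for i
  proof -
    have "g z \<in> grid s e" if "z \<in> grid s e" for z
      using Bij_imp_funcset[OF g] that by blast
    moreover have "bij_betw g (grid s e) (grid s e)" using g by (simp add: Bij_def)
    ultimately show ?thesis
      unfolding grid_partition_eq
      by (subst leaves_invariant_quotient_iff[OF equiv_level_relation])
        (auto simp: level_relation_def)
  qed
  then show ?thesis by (auto simp: wreath_def chain_stabiliser_def)
qed

lemma subgroup_wreath: "subgroup (wreath s e) (BijGroup (grid s e))"
  unfolding wreath_def by (rule subgroup_chain_stabiliser) (rule grid_partition_sub)

text \<open>A tree automorphism given by its local permutations: \<open>\<sigma> j t\<close> acts on
  coordinate \<open>j\<close> below the node \<open>t\<close>, where nodes are read off the original
  point and not its image.\<close>

definition level_map ::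
  "nat \<Rightarrow> (nat \<Rightarrow> nat) \<Rightarrow> (nat \<Rightarrow> (nat \<Rightarrow> nat) \<Rightarrow> nat \<Rightarrow> nat) \<Rightarrow> (nat \<Rightarrow> nat) \<Rightarrow> nat \<Rightarrow> nat" where
  "level_map s e \<sigma> = (\<lambda>x\<in>grid s e. \<lambda>j\<in>{1..s}. \<sigma> j (tail s j x) (x j))"

text \<open>The image's coordinate \<open>j\<close> depends only on the node at level
  \<open>j\<close> and on \<open>x j\<close>, so equal tails have equal images. The converse undoes
  the local permutations from the root downwards. Level 0 then gives injectivity, and finiteness of
  the grid gives surjectivity.\<close>

lemma level_map_in_wreath:
  assumes \<sigma>: "\<And>j t. j \<in> {1..s} \<Longrightarrow> bij_betw (\<sigma> j t) {..<e j} {..<e j}"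
  shows "level_map s e \<sigma> \<in> wreath s e"
proof -
  let ?P = "grid s e" and ?g = "level_map s e \<sigma>"
  have app: "?g x j = \<sigma> j (tail s j x) (x j)" if "x \<in> ?P" "j \<in> {1..s}" for x j
    using that by (simp add: level_map_def)
  have gP: "?g x \<in> ?P" if x: "x \<in> ?P" for x
  proof -
    have "\<sigma> j (tail s j x) (x j) < e j" if "j \<in> {1..s}" for j
      using \<sigma>[OF that] grid_apply_less[OF x that] by (auto simp: bij_betw_def)
    then show ?thesis using x by (auto simp: level_map_def grid_def)
  qed
  have tails: "tail s i (?g x) = tail s i (?g y) \<longleftrightarrow> tail s i x = tail s i y"
    if i: "i \<le> s" and x: "x \<in> ?P" and y: "y \<in> ?P" for i x y
  proof
    assume eq: "tail s i x = tail s i y"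
    have "?g x j = ?g y j" if j: "j \<in> {i<..s}" for j
    proof -
      have "tail s j x = tail s j y" using tail_eq_mono[OF _ eq, of j] j by simp
      moreover have "x j = y j" using eq j by (simp add: tail_eq_iff)
      ultimately show ?thesis using j x y by (simp add: app)
    qed
    then show "tail s i (?g x) = tail s i (?g y)" by (simp add: tail_eq_iff)
  next
    assume eq: "tail s i (?g x) = tail s i (?g y)"
    \<comment> \<open>The induction descends from level \<open>s\<close> to \<open>i\<close>: once
      the tails beyond \<open>Suc n\<close> agree, the same local permutation acts on both
      coordinates \<open>Suc n\<close>, and it is injective.\<close>
    show "tail s i x = tail s i y"
      using i
    proof (induction rule: inc_induct)
      case base show ?case by (simp add: tail_eq_iff)
    next
      case (step n)
      then have j: "Suc n \<in> {1..s}" by auto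
      have "\<sigma> (Suc n) (tail s (Suc n) y) (x (Suc n)) = \<sigma> (Suc n) (tail s (Suc n) y) (y (Suc n))"
      proof -
        have "?g x (Suc n) = ?g y (Suc n)" using eq step by (simp add: tail_eq_iff)
        then show ?thesis using step j x y by (simp add: app)
      qed
      then have "x (Suc n) = y (Suc n)"
        using \<sigma>[OF j, of "tail s (Suc n) y"] grid_apply_less[OF x j] grid_apply_less[OF y j]
        by (auto simp: bij_betw_def inj_on_def)
      with step show ?case by (simp add: tail_step_iff)
    qed
  qed
  have "inj_on ?g ?P"
    using tails[of 0] by (intro inj_onI) (metis grid_tail_0_eq le0)
  moreover have "?g ` ?P \<subseteq> ?P" using gP by auto
  ultimately have "bij_betw ?g ?P ?P"
    by (simp add: bij_betw_def endo_inj_surj finite_grid)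
  then have "?g \<in> Bij ?P" by (simp add: Bij_def level_map_def)
  with tails show ?thesis by (simp add: wreath_iff)
qed

section \<open>Extending and prescribing bijections of finite sets\<close>

lemma bij_betw_extend_finite:
  assumes "finite U" "A \<subseteq> U" "A' \<subseteq> U" and f: "bij_betw f A A'"
  obtains p where "bij_betw p U U" "\<And>a. a \<in> A \<Longrightarrow> p a = f a"
proof -
  \<comment> \<open>Equal cardinality of the two complements supplies the missing half of the
    permutation.\<close>
  have "card (U - A) = card (U - A')"
    using assms bij_betw_same_card[OF f] by (simp add: card_Diff_subset finite_subset)
  then obtain h where h: "bij_betw h (U - A) (U - A')"
    using finite_same_card_bij[of "U - A" "U - A'"] assms(1) by auto
  let ?p = "\<lambda>a. if a \<in> A then f a else h a"
  have "bij_betw ?p (A \<union> (U - A)) (A' \<union> (U - A'))"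
    by (rule bij_betw_disjoint_Un[OF f h]) auto
  then have "bij_betw ?p U U" using assms(2,3) by (simp add: Un_absorb1)
  with that show ?thesis by auto
qed

lemma bij_betw_lessThan_point:
  assumes "a \<in> A" "finite A" "card A = n"
  obtains f where "bij_betw f A {..<n}" "f a = (0::nat)"
proof -
  have n: "0 < n" using assms by (auto simp: card_gt_0_iff)
  have "card (A - {a}) = card ({..<n} - {0})" using assms n by simp
  then obtain h where "bij_betw h (A - {a}) ({..<n} - {0})"
    using finite_same_card_bij[of "A - {a}" "{..<n} - {0}"] assms(2) by auto
  moreover have "bij_betw (\<lambda>_. 0) {a} {0::nat}" by (simp add: bij_betw_def)
  ultimately have "bij_betw (\<lambda>x. if x \<in> {a} then 0 else h x) ({a} \<union> (A - {a})) ({0} \<union> ({..<n} - {0}))"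
    by (intro bij_betw_disjoint_Un) auto
  moreover have "{a} \<union> (A - {a}) = A" "{0} \<union> ({..<n} - {0}) = {..<n}" using assms n by auto
  ultimately show ?thesis using that by auto
qed

subsection \<open>Regular subsets\<close>

text \<open>In the tree spanned by \<open>X\<close>, these are the labels of the branches leaving
  the node \<open>t\<close> towards level \<open>j - 1\<close>.\<close>

definition children :: "nat \<Rightarrow> (nat \<Rightarrow> nat) set \<Rightarrow> nat \<Rightarrow> (nat \<Rightarrow> nat) \<Rightarrow> nat set" where
  "children s X j t = (\<lambda>z. z j) ` {z \<in> X. tail s j z = t}"

text \<open>Only nodes met by \<open>X\<close> are constrained, as they are written
  \<open>tail s j w\<close> with \<open>w\<close> in \<open>X\<close>. The empty set would satisfy
  the counting condition vacuously and is therefore excluded.\<close>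

definition regular :: "nat \<Rightarrow> (nat \<Rightarrow> nat) \<Rightarrow> (nat \<Rightarrow> nat) \<Rightarrow> (nat \<Rightarrow> nat) set \<Rightarrow> bool" where
  "regular s e x X \<longleftrightarrow> X \<subseteq> grid s e \<and> X \<noteq> {} \<and>
     (\<forall>w\<in>X. \<forall>j\<in>{1..s}. card (children s X j (tail s j w)) = x j)"

lemma children_sub: "X \<subseteq> grid s e \<Longrightarrow> j \<in> {1..s} \<Longrightarrow> children s X j t \<subseteq> {..<e j}"
  by (auto simp: children_def dest!: subsetD grid_apply_less)

text \<open>Both functions have the same fibres on \<open>A\<close>, so sending \<open>f a\<close>
  to \<open>h a\<close> is a well-defined bijection of the images; \<open>SOME\<close> picks a
  representative of the fibre.\<close>

lemma card_image_cong_fibres: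
  assumes "\<And>a b. a \<in> A \<Longrightarrow> b \<in> A \<Longrightarrow> f a = f b \<longleftrightarrow> h a = h b"
  shows "card (f ` A) = card (h ` A)"
proof (rule bij_betw_same_card)
  let ?g = "\<lambda>u. h (SOME a. a \<in> A \<and> f a = u)"
  have g: "?g (f a) = h a" if "a \<in> A" for a
    using someI[of "\<lambda>b. b \<in> A \<and> f b = f a" a] assms that by blast
  show "bij_betw ?g (f ` A) (h ` A)"
    unfolding bij_betw_def
  proof
    show "inj_on ?g (f ` A)" using g assms by (auto intro!: inj_onI)
    show "?g ` f ` A = h ` A" unfolding image_image using g by (rule image_cong[OF refl])
  qed
qed

text \<open>An arbitrary \<open>g\<close> is not presented by local permutations, so children are
  counted through fibres: among points with a common tail beyond \<open>j\<close>, agreement in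
  coordinate \<open>j\<close> is agreement of the tails beyond \<open>j - 1\<close>, which
  \<open>g\<close> preserves and reflects.\<close>

lemma regular_image:
  assumes g: "g \<in> wreath s e" and X: "regular s e x X"
  shows "regular s e x (g ` X)"
proof -
  have gP: "g z \<in> grid s e" if "z \<in> grid s e" for z
    using g Bij_imp_funcset[of g "grid s e"] that by (auto simp: wreath_iff)
  have XP: "X \<subseteq> grid s e" using X by (simp add: regular_def)
  have tails: "tail s i (g z) = tail s i (g w) \<longleftrightarrow> tail s i z = tail s i w"
    if "i \<le> s" "z \<in> X" "w \<in> X" for i z w
    using g that XP by (auto simp: wreath_iff)
  have "card (children s (g ` X) j (tail s j (g w))) = x j" if w: "w \<in> X" and j: "j \<in> {1..s}" for w j
  proof -
    let ?Z = "{z \<in> X. tail s j z = tail s j w}"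
    have eq: "z j = z' j \<longleftrightarrow> g z j = g z' j" if "z \<in> ?Z" "z' \<in> ?Z" for z z'
      using that j tails[of j z z'] tails[of "j - 1" z z'] tail_pred_iff[OF j] by auto
    have "{z \<in> g ` X. tail s j z = tail s j (g w)} = g ` ?Z"
      using tails[of j] w j by auto
    then have "children s (g ` X) j (tail s j (g w)) = (\<lambda>z. g z j) ` ?Z"
      unfolding children_def by (simp add: image_image)
    then show ?thesis
      using X w j card_image_cong_fibres[of ?Z "\<lambda>z. z j" "\<lambda>z. g z j"] eq
      by (simp add: regular_def children_def)
  qed
  then show ?thesis using X gP by (auto simp: regular_def)
qed

lemma grid_mono: "(\<And>j. j \<in> {1..s} \<Longrightarrow> x j \<le> e j) \<Longrightarrow> grid s x \<subseteq> grid s e"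
  unfolding grid_def by (rule PiE_mono) auto

lemma regular_grid:
  assumes x: "\<And>j. j \<in> {1..s} \<Longrightarrow> 0 < x j \<and> x j \<le> e j"
  shows "regular s e x (grid s x)"
proof -
  have "children s (grid s x) j (tail s j w) = {..<x j}" if w: "w \<in> grid s x" and j: "j \<in> {1..s}" for w j
  proof
    show "{..<x j} \<subseteq> children s (grid s x) j (tail s j w)"
    proof
      fix a assume "a \<in> {..<x j}"
      \<comment> \<open>Changing coordinate \<open>j\<close> stays inside the smaller grid and does
        not affect the tail beyond \<open>j\<close>.\<close>
      then have "w(j := a) \<in> grid s x" "tail s j (w(j := a)) = tail s j w"
        using w j by (auto simp: grid_def PiE_iff extensional_def tail_eq_iff)
      then show "a \<in> children s (grid s x) j (tail s j w)"
        unfolding children_def by (intro image_eqI[of _ _ "w(j := a)"]) auto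
    qed
  qed (use children_sub[OF order_refl j] in auto)
  moreover have "grid s x \<noteq> {}"
    unfolding grid_def using x by (force simp: PiE_eq_empty_iff)
  ultimately show ?thesis
    using grid_mono[of s x e] x by (simp add: regular_def)
qed

text \<open>The standard block has the same child set \<open>{..<x j}\<close> below every tail, so a level map onto
  it needs no knowledge of the images of the tails.\<close>

lemma regular_to_standard:
  assumes X: "regular s e x X" and w: "w \<in> X"
    and x: "\<And>j. j \<in> {1..s} \<Longrightarrow> 0 < x j \<and> x j \<le> e j"
  obtains g where "g \<in> wreath s e" "g ` X = grid s x" "g w = (\<lambda>j\<in>{1..s}. 0)"
proof -
  have XP: "X \<subseteq> grid s e" and card: "\<And>z j. z \<in> X \<Longrightarrow> j \<in> {1..s} \<Longrightarrow> card (children s X j (tail s j z)) = x j"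
    using X by (auto simp: regular_def)
  \<comment> \<open>A local permutation is chosen for every node: it moves the children in
    \<open>X\<close> onto an initial segment, and on the path to \<open>w\<close> it also sends the
    branch taken by \<open>w\<close> to 0.\<close>
  have "\<exists>p. j \<in> {1..s} \<longrightarrow> bij_betw p {..<e j} {..<e j} \<and>
        (children s X j t \<noteq> {} \<longrightarrow> p ` children s X j t = {..<x j}) \<and>
        (t = tail s j w \<longrightarrow> p (w j) = 0)" for j t
  proof (cases "j \<in> {1..s} \<and> children s X j t \<noteq> {}")
    case True
    then obtain z where z: "z \<in> X" "tail s j z = t" by (auto simp: children_def)
    \<comment> \<open>The child to be sent to 0 is forced on the path to \<open>w\<close> and
      arbitrary elsewhere.\<close>
    obtain a where a: "a \<in> children s X j t" "t = tail s j w \<longrightarrow> a = w j"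
      using True w by (cases "t = tail s j w") (auto simp: children_def)
    have fin: "finite (children s X j t)"
      using children_sub[OF XP, of j t] True by (meson finite_lessThan finite_subset)
    obtain f where f: "bij_betw f (children s X j t) {..<x j}" "f a = 0"
      using bij_betw_lessThan_point[OF a(1) fin refl] card[OF z(1), of j] z(2) True by auto
    obtain p where "bij_betw p {..<e j} {..<e j}" "\<And>a. a \<in> children s X j t \<Longrightarrow> p a = f a"
      using bij_betw_extend_finite[OF _ children_sub[OF XP, of j t] _ f(1)] x[of j] True by auto
    then show ?thesis using f a by (intro exI[of _ p]) (auto simp: bij_betw_def)
  next
    case False
    \<comment> \<open>With \<open>j\<close> in range and no children, \<open>t\<close> is not on the
      path to \<open>w\<close>, so the identity meets every demand.\<close>
    then show ?thesis using w by (intro exI[of _ id]) (auto simp: children_def)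
  qed
  then obtain \<sigma> where \<sigma>: "\<And>j t. j \<in> {1..s} \<Longrightarrow> bij_betw (\<sigma> j t) {..<e j} {..<e j}"
    "\<And>j t. j \<in> {1..s} \<Longrightarrow> children s X j t \<noteq> {} \<Longrightarrow> \<sigma> j t ` children s X j t = {..<x j}"
    "\<And>j. j \<in> {1..s} \<Longrightarrow> \<sigma> j (tail s j w) (w j) = 0"
    by metis
  let ?g = "level_map s e \<sigma>"
  have app: "?g z j = \<sigma> j (tail s j z) (z j)" if "z \<in> grid s e" "j \<in> {1..s}" for z j
    using that by (simp add: level_map_def)
  have g: "?g \<in> wreath s e" by (rule level_map_in_wreath) (rule \<sigma>)
  then have surj: "?g ` grid s e = grid s e" by (auto simp: wreath_iff Bij_def bij_betw_def)
  have "?g z \<in> grid s x" if z: "z \<in> X" for z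
  proof -
    have "?g z j < x j" if j: "j \<in> {1..s}" for j
    proof -
      have "z j \<in> children s X j (tail s j z)" using z by (auto simp: children_def)
      then have "\<sigma> j (tail s j z) (z j) \<in> {..<x j}" using \<sigma>(2)[OF j, of "tail s j z"] by auto
      then show ?thesis using app j z XP by auto
    qed
    moreover have "?g z \<in> extensional {1..s}" using z XP by (auto simp: level_map_def)
    ultimately show ?thesis by (auto simp: grid_def PiE_iff)
  qed
  moreover have "u \<in> ?g ` X" if u: "u \<in> grid s x" for u
  proof -
    have "u \<in> grid s e" using u grid_mono[of s x e] x by auto
    then obtain z where z: "z \<in> grid s e" "u = ?g z" using surj by blast
    \<comment> \<open>The preimage \<open>z\<close> of \<open>u\<close> is traced from the root
      down. If its node at level \<open>Suc n\<close> is met by \<open>X\<close>, the image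
      coordinate lies below \<open>x (Suc n)\<close>, so injectivity of the local permutation makes
      \<open>z (Suc n)\<close> one of the children. At level 0 this puts \<open>z\<close> itself in
      \<open>X\<close>.\<close>
    have "\<exists>z'\<in>X. tail s 0 z' = tail s 0 z"
      using le0[of s]
    proof (induction rule: inc_induct)
      case base show ?case using w by (auto simp: tail_eq_iff)
    next
      case (step n)
      let ?j = "Suc n" and ?S = "children s X (Suc n) (tail s (Suc n) z)"
      have j: "?j \<in> {1..s}" using step by auto
      obtain z' where z': "z' \<in> X" "tail s ?j z' = tail s ?j z" using step by auto
      then have "?S \<noteq> {}" by (auto simp: children_def)
      moreover have "\<sigma> ?j (tail s ?j z) (z ?j) < x ?j"
        using app[OF z(1) j] u z(2) grid_apply_less[OF u j] by simp
      ultimately have "\<sigma> ?j (tail s ?j z) (z ?j) \<in> \<sigma> ?j (tail s ?j z) ` ?S"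
        using \<sigma>(2)[OF j] by auto
      then have "z ?j \<in> ?S"
        using \<sigma>(1)[OF j, of "tail s ?j z"] children_sub[OF XP j] grid_apply_less[OF z(1) j]
        by (meson bij_betw_def inj_on_image_mem_iff lessThan_iff)
      then show ?case using step by (auto simp: children_def tail_step_iff)
    qed
    then have "z \<in> X" using z XP by (metis grid_tail_0_eq subsetD)
    then show ?thesis using z by blast
  qed
  ultimately have "?g ` X = grid s x" by blast
  moreover have "?g w = (\<lambda>j\<in>{1..s}. 0)"
    using w XP \<sigma>(3) by (auto simp: level_map_def fun_eq_iff)
  ultimately show ?thesis using that g by blast
qed

text \<open>The pairs separating at level \<open>i\<close> form one orbit. Above \<open>i\<close>
  the two points share their path, at \<open>i\<close> one permutation must send the two distinct
  branches to 0 and 1, and below \<open>i\<close> they sit under different nodes and can be moved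
  independently.\<close>

lemma pair_to_standard:
  assumes pq: "p \<in> grid s e" "q \<in> grid s e" and i: "i \<in> {1..s}"
    and tl: "tail s i p = tail s i q" and ne: "p i \<noteq> q i"
  obtains g where "g \<in> wreath s e" "g p = (\<lambda>j\<in>{1..s}. 0)" "g q = (\<lambda>j\<in>{1..s}. if j = i then 1 else 0)"
proof -
  have "\<exists>f. j \<in> {1..s} \<longrightarrow> bij_betw f {..<e j} {..<e j} \<and>
        (t = tail s j p \<longrightarrow> f (p j) = 0) \<and>
        (t = tail s j q \<longrightarrow> f (q j) = (if j = i then 1 else 0))" for j t
  proof (cases "j \<in> {1..s}")
    case True
    have lt: "p j < e j" "q j < e j" using pq grid_apply_less True by auto
    have one: "\<exists>f. bij_betw f {..<e j} {..<e j} \<and> f c = 0" if "c < e j" for c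
      using bij_betw_lessThan_point[of c "{..<e j}"] that by auto
    show ?thesis
    proof (cases "j = i")
      case True
      define h where "h c = (if c = p j then 0 else 1::nat)" for c
      have "{0, 1} \<subseteq> {..<e j}" using lt ne True by auto
      moreover have "bij_betw h {p j, q j} {0, 1}"
        using ne True by (auto simp: bij_betw_def h_def)
      ultimately obtain f where "bij_betw f {..<e j} {..<e j}" "\<And>c. c \<in> {p j, q j} \<Longrightarrow> f c = h c"
        using bij_betw_extend_finite[of "{..<e j}" "{p j, q j}" "{0, 1}" h] lt by auto
      then show ?thesis using ne True tl by (intro exI[of _ f]) (auto simp: h_def)
    next
      case False
      \<comment> \<open>If both points pass through the same node at a level other than
        \<open>i\<close>, that level is above \<open>i\<close>, so their branches coincide and the
        two demands on \<open>f\<close> are the same.\<close>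
      have "t = tail s j p \<Longrightarrow> t = tail s j q \<Longrightarrow> p j = q j"
      proof -
        assume "t = tail s j p" "t = tail s j q"
        then have "\<not> j < i" using ne i by (auto simp: tail_eq_iff)
        then show "p j = q j" using False tl \<open>j \<in> {1..s}\<close> by (simp add: tail_eq_iff)
      qed
      then show ?thesis
        using False one[OF lt(1)] one[OF lt(2)]
        by (cases "t = tail s j p"; cases "t = tail s j q") auto
    qed
  qed auto
  then obtain \<sigma> where \<sigma>: "\<And>j t. j \<in> {1..s} \<Longrightarrow> bij_betw (\<sigma> j t) {..<e j} {..<e j}"
    "\<And>j. j \<in> {1..s} \<Longrightarrow> \<sigma> j (tail s j p) (p j) = 0"
    "\<And>j. j \<in> {1..s} \<Longrightarrow> \<sigma> j (tail s j q) (q j) = (if j = i then 1 else 0)"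
    by metis
  have "level_map s e \<sigma> \<in> wreath s e" by (rule level_map_in_wreath) (rule \<sigma>)
  moreover have "level_map s e \<sigma> p = (\<lambda>j\<in>{1..s}. 0)"
    using pq \<sigma>(2) by (auto simp: level_map_def fun_eq_iff)
  moreover have "level_map s e \<sigma> q = (\<lambda>j\<in>{1..s}. if j = i then 1 else 0)"
    using pq \<sigma>(3) by (auto simp: level_map_def fun_eq_iff)
  ultimately show ?thesis using that by blast
qed

text \<open>Regularity is invariant under the group, and every regular set can be moved to the
  standard grid; inverting that move puts it in the orbit. Blocks can then be counted by a
  combinatorial condition.\<close>

lemma block_orbit_eq_regular:
  assumes x: "\<And>j. j \<in> {1..s} \<Longrightarrow> 0 < x j \<and> x j \<le> e j"
  shows "block_orbit (wreath s e) (grid s x) = {X. regular s e x X}"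
proof (intro equalityI subsetI)
  fix X assume "X \<in> block_orbit (wreath s e) (grid s x)"
  then show "X \<in> {X. regular s e x X}"
    using regular_image regular_grid[of s x e] x by (auto simp: block_orbit_def)
next
  fix X assume "X \<in> {X. regular s e x X}"
  then have X: "regular s e x X" by simp
  then have XP: "X \<subseteq> grid s e" and "X \<noteq> {}" by (auto simp: regular_def)
  then obtain w where "w \<in> X" by blast
  then obtain g where g: "g \<in> wreath s e" "g ` X = grid s x"
    using regular_to_standard[OF X] x by metis
  have "(\<lambda>z\<in>grid s e. inv_into (grid s e) g z) ` grid s x = X"
    using image_restrict_inv_into[OF subgroup_Bij[OF subgroup_wreath g(1)] XP] g(2) by simp
  then show "X \<in> block_orbit (wreath s e) (grid s x)"
    unfolding block_orbit_def using subgroup_inverse[OF subgroup_wreath g(1)] by blast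
qed

subsection \<open>Counting regular subsets\<close>

text \<open>The subtree of \<open>X\<close> under the branch \<open>a\<close> at the root, with the
  top coordinate stripped so that it lives in the grid with one level fewer.\<close>

definition slice :: "nat \<Rightarrow> (nat \<Rightarrow> nat) \<Rightarrow> nat \<Rightarrow> (nat \<Rightarrow> nat) set \<Rightarrow> (nat \<Rightarrow> nat) set" where
  "slice s e a X = {z \<in> grid s e. z(Suc s := a) \<in> X}"

abbreviation top_entries :: "nat \<Rightarrow> (nat \<Rightarrow> nat) set \<Rightarrow> nat set" where
  "top_entries s X \<equiv> (\<lambda>z. z (Suc s)) ` X"

lemma grid_Suc_drop: "z \<in> grid (Suc s) e \<Longrightarrow> z(Suc s := undefined) \<in> grid s e"
  by (auto simp: grid_def PiE_iff extensional_def)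

lemma grid_Suc_upd: "u \<in> grid s e \<Longrightarrow> a < e (Suc s) \<Longrightarrow> u(Suc s := a) \<in> grid (Suc s) e"
  by (auto simp: grid_def PiE_iff extensional_def)

lemma grid_upd_undefined: "u \<in> grid s e \<Longrightarrow> u(Suc s := undefined) = u"
  by (auto simp: grid_def PiE_iff extensional_def fun_eq_iff)

lemma tail_Suc_eq_iff:
  "j \<le> s \<Longrightarrow> tail (Suc s) j z = tail (Suc s) j w \<longleftrightarrow> tail s j z = tail s j w \<and> z (Suc s) = w (Suc s)"
  by (auto simp: tail_eq_iff le_Suc_eq)

lemma children_slice:
  assumes X: "X \<subseteq> grid (Suc s) e" and j: "j \<in> {1..s}"
  shows "children (Suc s) X j (tail (Suc s) j (u(Suc s := a))) = children s (slice s e a X) j (tail s j u)"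
proof (intro equalityI subsetI)
  fix c assume "c \<in> children (Suc s) X j (tail (Suc s) j (u(Suc s := a)))"
  then obtain z where z: "z \<in> X" "tail s j z = tail s j (u(Suc s := a))" "z (Suc s) = a" "c = z j"
    using j by (auto simp: children_def tail_Suc_eq_iff)
  let ?z = "z(Suc s := undefined)"
  have "?z \<in> slice s e a X" using z X grid_Suc_drop[of z s e] by (auto simp: slice_def)
  moreover have "tail s j ?z = tail s j u" using z by (simp add: tail_eq_iff)
  moreover have "c = ?z j" using z j by simp
  ultimately show "c \<in> children s (slice s e a X) j (tail s j u)"
    unfolding children_def by blast
next
  fix c assume "c \<in> children s (slice s e a X) j (tail s j u)"
  then obtain z where z: "z \<in> grid s e" "z(Suc s := a) \<in> X" "tail s j z = tail s j u" "c = z j"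
    by (auto simp: children_def slice_def)
  then have "tail (Suc s) j (z(Suc s := a)) = tail (Suc s) j (u(Suc s := a))"
    using j by (simp add: tail_Suc_eq_iff tail_eq_iff)
  then show "c \<in> children (Suc s) X j (tail (Suc s) j (u(Suc s := a)))"
    using z j unfolding children_def by (intro image_eqI[of _ _ "z(Suc s := a)"]) auto
qed

text \<open>No coordinate lies beyond \<open>s\<close>, so every point has the root as its tail, and
  restriction to the empty index set represents the root by the constant
  \<open>undefined\<close>.\<close>

lemma children_top: "children s X s t = (if t = (\<lambda>_. undefined) then (\<lambda>z. z s) ` X else {})"
  by (auto simp: children_def tail_def restrict_def)

text \<open>The condition at the root concerns the top entries alone, and every lower node lies in
  exactly one slice. Positivity of \<open>x (Suc s)\<close> makes \<open>X\<close> nonempty in the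
  converse direction.\<close>

lemma regular_Suc_iff:
  assumes x: "0 < x (Suc s)"
  shows "regular (Suc s) e x X \<longleftrightarrow> X \<subseteq> grid (Suc s) e \<and> card (top_entries s X) = x (Suc s) \<and>
    (\<forall>a \<in> top_entries s X. regular s e x (slice s e a X))" (is "?L \<longleftrightarrow> ?R")
proof
  assume X: ?L
  then have XP: "X \<subseteq> grid (Suc s) e" and "X \<noteq> {}" and
    card: "\<And>w j. w \<in> X \<Longrightarrow> j \<in> {1..Suc s} \<Longrightarrow> card (children (Suc s) X j (tail (Suc s) j w)) = x j"
    by (auto simp: regular_def)
  then obtain w where "w \<in> X" by blast
  then have top: "card (top_entries s X) = x (Suc s)"
    using card[of w "Suc s"] by (simp add: children_top tail_def restrict_def)
  have "regular s e x (slice s e (w (Suc s)) X)" if w: "w \<in> X" for w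
  proof -
    let ?a = "w (Suc s)"
    have "w(Suc s := undefined) \<in> slice s e ?a X"
      using w XP grid_Suc_drop[of w s e] by (auto simp: slice_def)
    moreover have "card (children s (slice s e ?a X) j (tail s j u)) = x j"
      if "u \<in> slice s e ?a X" "j \<in> {1..s}" for u j
      using children_slice[OF XP that(2), of u ?a] card[of "u(Suc s := ?a)" j] that
      by (auto simp: slice_def)
    ultimately show ?thesis by (auto simp: regular_def slice_def)
  qed
  with XP top show ?R by auto
next
  assume R: ?R
  then have XP: "X \<subseteq> grid (Suc s) e" by simp
  have "X \<noteq> {}" using R x by auto
  moreover have "card (children (Suc s) X j (tail (Suc s) j w)) = x j"
    if w: "w \<in> X" and j: "j \<in> {1..Suc s}" for w j
  proof (cases "j = Suc s")
    case True
    then show ?thesis using R by (simp add: children_top tail_def restrict_def)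
  next
    case False
    let ?a = "w (Suc s)" and ?u = "w(Suc s := undefined)"
    have "?u \<in> slice s e ?a X" using w XP grid_Suc_drop[of w s e] by (auto simp: slice_def)
    moreover have "regular s e x (slice s e ?a X)" using R w by blast
    ultimately have "card (children s (slice s e ?a X) j (tail s j ?u)) = x j"
      using False j by (simp add: regular_def)
    then show ?thesis using children_slice[OF XP, of j ?u ?a] False j by simp
  qed
  ultimately show ?L using XP by (simp add: regular_def)
qed

text \<open>A regular set amounts to a choice of branches at the root together with an independent
  choice of a regular subtree under each of them. Extensional functions make the second choice
  unique as an object.\<close>

lemma bij_betw_regular_Suc:
  assumes x: "0 < x (Suc s)"
  shows "bij_betw (\<lambda>X. (top_entries s X, \<lambda>a\<in>top_entries s X. slice s e a X))
    {X. regular (Suc s) e x X}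
    (SIGMA A:{A. A \<subseteq> {..<e (Suc s)} \<and> card A = x (Suc s)}. A \<rightarrow>\<^sub>E {X. regular s e x X})"
    (is "bij_betw ?f ?R ?S")
proof -
  \<comment> \<open>The inverse hangs the subtree \<open>c a\<close> under each chosen branch
    \<open>a\<close>.\<close>
  let ?g = "\<lambda>(A, c). {z \<in> grid (Suc s) e. z (Suc s) \<in> A \<and> z(Suc s := undefined) \<in> c (z (Suc s))}"
  have gf: "?g (?f X) = X" if "X \<in> ?R" for X
  proof -
    have "X \<subseteq> grid (Suc s) e" using that by (auto simp: regular_def)
    then show ?thesis by (auto simp: slice_def grid_Suc_drop)
  qed
  have f_in: "?f X \<in> ?S" if "X \<in> ?R" for X
  proof -
    have "X \<subseteq> grid (Suc s) e" using that by (auto simp: regular_def)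
    then have "top_entries s X \<subseteq> {..<e (Suc s)}"
      using grid_apply_less[of _ "Suc s" e "Suc s"] by auto
    moreover have "card (top_entries s X) = x (Suc s)"
      "\<And>a. a \<in> top_entries s X \<Longrightarrow> regular s e x (slice s e a X)"
      using that regular_Suc_iff[of x s, OF x] by blast+
    ultimately show ?thesis by (simp only: mem_Sigma_iff mem_Collect_eq restrict_PiE_iff) blast
  qed
  have g: "slice s e a (?g (A, c)) = c a" "top_entries s (?g (A, c)) = A"
    if S: "(A, c) \<in> ?S" and a: "a \<in> A" for A c a
  proof -
    have A: "A \<subseteq> {..<e (Suc s)}" using S by auto
    have c: "regular s e x (c a)" if "a \<in> A" for a using S that by auto
    then have ca: "c a \<subseteq> grid s e" "c a \<noteq> {}" if "a \<in> A" for a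
      using that by (auto simp: regular_def)
    have mem: "u(Suc s := a) \<in> ?g (A, c) \<longleftrightarrow> u \<in> c a" if "u \<in> grid s e" "a \<in> A" for u a
      using that A grid_Suc_upd[of u s e a] by (auto simp: grid_upd_undefined)
    show "slice s e a (?g (A, c)) = c a"
      unfolding slice_def using mem[OF _ a] ca[OF a] by blast
    show "top_entries s (?g (A, c)) = A"
    proof
      show "A \<subseteq> top_entries s (?g (A, c))"
      proof
        fix a assume a: "a \<in> A"
        then obtain u where "u \<in> c a" using ca by blast
        then have "u(Suc s := a) \<in> ?g (A, c)" using mem[OF _ a] ca[OF a] by blast
        then show "a \<in> top_entries s (?g (A, c))" by (rule image_eqI[rotated]) simp
      qed
    qed auto
  qed
  have fg: "?f (?g (A, c)) = (A, c) \<and> ?g (A, c) \<in> ?R" if S: "(A, c) \<in> ?S" for A c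
  proof -
    have "card A = x (Suc s)" using S by auto
    then obtain a where a: "a \<in> A" using x by fastforce
    have top: "top_entries s (?g (A, c)) = A" by (rule g(2)[OF S a])
    have "(\<lambda>a\<in>A. slice s e a (?g (A, c))) = (\<lambda>a\<in>A. c a)"
      by (rule restrict_ext) (rule g(1)[OF S])
    also have "\<dots> = c" using S by (auto intro!: extensional_restrict simp: PiE_iff)
    finally have "?f (?g (A, c)) = (A, c)" using top by simp
    moreover have "?g (A, c) \<in> ?R"
      unfolding mem_Collect_eq
    proof (subst regular_Suc_iff[of x s, OF x], intro conjI ballI)
      show "?g (A, c) \<subseteq> grid (Suc s) e" by auto
      show "card (top_entries s (?g (A, c))) = x (Suc s)" using top \<open>card A = _\<close> by simp
      fix a assume "a \<in> top_entries s (?g (A, c))"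
      then have "a \<in> A" using top by simp
      moreover from this have "regular s e x (c a)" using S by auto
      ultimately show "regular s e x (slice s e a (?g (A, c)))" using g(1)[OF S] by simp
    qed
    ultimately show ?thesis by blast
  qed
  have fg': "?f (?g u) = u \<and> ?g u \<in> ?R" if "u \<in> ?S" for u
    using fg[of "fst u" "snd u"] that unfolding prod.collapse .
  show ?thesis
  proof (rule bij_betw_byWitness[where f' = ?g])
    show "\<forall>X\<in>?R. ?g (?f X) = X" by (intro ballI gf)
    show "\<forall>u\<in>?S. ?f (?g u) = u" by (intro ballI) (rule conjunct1[OF fg'])
    show "?f ` ?R \<subseteq> ?S" by (rule image_subsetI) (rule f_in)
    show "?g ` ?S \<subseteq> ?R" by (rule image_subsetI) (rule conjunct2[OF fg'])
  qed
qed

lemma finite_regular: "finite {X. regular s e x X}"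
  by (rule finite_subset[of _ "Pow (grid s e)"]) (auto simp: regular_def finite_grid)

text \<open>The count satisfies N(s+1) = (\<open>e (Suc s)\<close> choose \<open>x (Suc s)\<close>)
  * N(s)^\<open>x (Suc s)\<close>. The power multiplies every earlier exponent by
  \<open>x (Suc s)\<close>, which yields the products over higher levels.\<close>

lemma card_regular:
  assumes "\<And>j. j \<in> {1..s} \<Longrightarrow> 0 < x j"
  shows "card {X. regular s e x X} = (\<Prod>i=1..s. (e i choose x i) ^ (\<Prod>j\<in>{i<..s}. x j))"
  using assms
proof (induction s)
  case 0
  \<comment> \<open>With no coordinates the grid has the single point
    \<open>\<lambda>_. undefined\<close>, and the only regular set is the whole grid.\<close>
  have "regular 0 e x X \<longleftrightarrow> X = {\<lambda>_. undefined}" for X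
    by (auto simp: regular_def grid_def)
  then show ?case by simp
next
  case (Suc s)
  let ?R = "{X. regular s e x X}" and ?x = "x (Suc s)"
  let ?A = "{A. A \<subseteq> {..<e (Suc s)} \<and> card A = ?x}"
  have fin: "finite A" if "A \<in> ?A" for A using that finite_subset by auto
  have "card {X. regular (Suc s) e x X} = card (SIGMA A:?A. A \<rightarrow>\<^sub>E ?R)"
    using Suc.prems by (intro bij_betw_same_card[OF bij_betw_regular_Suc]) simp
  also have "\<dots> = (\<Sum>A\<in>?A. card (A \<rightarrow>\<^sub>E ?R))"
    using fin finite_regular by (intro card_SigmaI) (auto intro!: finite_PiE)
  also have "\<dots> = (\<Sum>A\<in>?A. card ?R ^ ?x)"
  proof (rule sum.cong[OF refl])
    fix A assume A: "A \<in> ?A"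
    then show "card (A \<rightarrow>\<^sub>E ?R) = card ?R ^ ?x" using card_PiE[OF fin[OF A], of "\<lambda>_. ?R"] by simp
  qed
  also have "\<dots> = (e (Suc s) choose ?x) * card ?R ^ ?x"
    using n_subsets[of "{..<e (Suc s)}" ?x] by simp
  also have "card ?R ^ ?x = (\<Prod>i=1..s. (e i choose x i) ^ (\<Prod>j\<in>{i<..Suc s}. x j))"
  proof -
    have "(\<Prod>j\<in>{i<..Suc s}. x j) = (\<Prod>j\<in>{i<..s}. x j) * ?x" if "i \<in> {1..s}" for i
    proof -
      have "{i<..Suc s} = insert (Suc s) {i<..s}" using that by auto
      then show ?thesis by simp
    qed
    then show ?thesis using Suc by (simp add: prod_power_distrib power_mult)
  qed
  finally show ?case by (simp add: mult.commute)
qed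

subsection \<open>Counting pairs of points\<close>

text \<open>Ordered pairs whose highest differing coordinate is \<open>i\<close>; equivalently
  \<open>i\<close> is the least level at which the two points share a class.\<close>

definition level_pairs ::
  "nat \<Rightarrow> (nat \<Rightarrow> nat) set \<Rightarrow> nat \<Rightarrow> ((nat \<Rightarrow> nat) \<times> (nat \<Rightarrow> nat)) set" where
  "level_pairs s X i = {(p, q) \<in> X \<times> X. tail s i p = tail s i q \<and> tail s (i - 1) p \<noteq> tail s (i - 1) q}"

lemma card_level_pairs_grid:
  assumes i: "i \<in> {1..s}"
  shows "card (level_pairs s (grid s e) i) = (\<Prod>j=1..s. e j) * ((e i - 1) * (\<Prod>j\<in>{1..<i}. e j))"
proof -
  let ?Q = "\<lambda>p. {q \<in> grid s e. tail s i p = tail s i q \<and> tail s (i - 1) p \<noteq> tail s (i - 1) q}"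
  have "card (?Q p) = (e i - 1) * (\<Prod>j\<in>{1..<i}. e j)" if p: "p \<in> grid s e" for p
  proof -
    \<comment> \<open>For a fixed \<open>p\<close>, its partners form a product set: free below
      \<open>i\<close>, any value but \<open>p i\<close> at \<open>i\<close>, and forced beyond
      \<open>i\<close>.\<close>
    let ?F = "\<lambda>j. if j < i then {..<e j} else if j = i then {..<e i} - {p i} else {p j}"
    have mem: "q \<in> ?Q p \<longleftrightarrow> q \<in> Pi\<^sub>E {1..s} ?F" for q
    proof -
      have "q \<in> ?Q p \<longleftrightarrow> q \<in> grid s e \<and> (\<forall>j\<in>{i<..s}. p j = q j) \<and> p i \<noteq> q i"
        using tail_pred_iff[OF i, of p q] by (auto simp: tail_eq_iff[of s i])
      also have "\<dots> \<longleftrightarrow> q \<in> Pi\<^sub>E {1..s} ?F"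
      proof
        assume "q \<in> grid s e \<and> (\<forall>j\<in>{i<..s}. p j = q j) \<and> p i \<noteq> q i"
        then show "q \<in> Pi\<^sub>E {1..s} ?F" by (auto simp: grid_def PiE_iff)
      next
        assume q: "q \<in> Pi\<^sub>E {1..s} ?F"
        have F: "?F j \<subseteq> {..<e j}" if "j \<in> {1..s}" for j
          using grid_apply_less[OF p that] by auto
        have qj: "q j \<in> ?F j" if "j \<in> {1..s}" for j using q that by (rule PiE_mem)
        have "q \<in> grid s e" using PiE_mono[of "{1..s}" ?F "\<lambda>j. {..<e j}"] F q by (auto simp: grid_def)
        moreover have "p j = q j" if "j \<in> {i<..s}" for j using qj[of j] that by auto
        moreover have "p i \<noteq> q i" using qj[OF i] by simp
        ultimately show "q \<in> grid s e \<and> (\<forall>j\<in>{i<..s}. p j = q j) \<and> p i \<noteq> q i" by blast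
      qed
      finally show ?thesis .
    qed
    have "?Q p = Pi\<^sub>E {1..s} ?F" by (rule Set.set_eqI) (rule mem)
    then have "card (?Q p) = card (Pi\<^sub>E {1..s} ?F)" by (rule arg_cong)
    also have "\<dots> = (\<Prod>j=1..s. card (?F j))" by (rule card_PiE) simp
    also have "{1..s} = {1..<i} \<union> insert i {i<..s}" using i by auto
    also have "(\<Prod>j\<in>{1..<i} \<union> insert i {i<..s}. card (?F j)) = (\<Prod>j\<in>{1..<i}. card (?F j)) * (\<Prod>j\<in>insert i {i<..s}. card (?F j))"
      by (rule prod.union_disjoint) auto
    also have "(\<Prod>j\<in>insert i {i<..s}. card (?F j)) = card (?F i) * (\<Prod>j\<in>{i<..s}. card (?F j))"
      by (rule prod.insert) auto
    also have "(\<Prod>j\<in>{i<..s}. card (?F j)) = 1" by (rule prod.neutral) auto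
    also have "(\<Prod>j\<in>{1..<i}. card (?F j)) = (\<Prod>j\<in>{1..<i}. e j)" by (rule prod.cong) auto
    also have "card (?F i) = e i - 1" using grid_apply_less[OF p i] by simp
    finally show ?thesis by (simp add: mult.commute)
  qed
  moreover have "level_pairs s (grid s e) i = (SIGMA p:grid s e. ?Q p)"
    by (auto simp: level_pairs_def)
  ultimately show ?thesis by (simp add: card_SigmaI finite_grid card_grid)
qed

lemma card_level_pairs_image:
  assumes g: "g \<in> wreath s e" and X: "X \<subseteq> grid s e" and i: "i \<le> s"
  shows "card (level_pairs s (g ` X) i) = card (level_pairs s X i)"
proof -
  have inj: "inj_on g X" using g X by (auto simp: wreath_iff Bij_def bij_betw_def intro: inj_on_subset)
  have tails: "tail s j (g p) = tail s j (g q) \<longleftrightarrow> tail s j p = tail s j q"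
    if "j \<le> s" "p \<in> X" "q \<in> X" for j p q
    using g that X by (auto simp: wreath_iff)
  have "level_pairs s (g ` X) i = map_prod g g ` level_pairs s X i"
    using tails i by (fastforce simp: level_pairs_def image_iff)
  moreover have "inj_on (map_prod g g) (level_pairs s X i)"
    by (rule inj_on_subset[OF map_prod_inj_on[OF inj inj]]) (auto simp: level_pairs_def)
  ultimately show ?thesis by (simp add: card_image)
qed

text \<open>The level is the least one at which the tails agree. It exists because all tails beyond
  \<open>s\<close> agree, and it is not 0 because the points are distinct.\<close>

lemma level_pairs_cover:
  assumes "p \<in> X" "q \<in> X" "X \<subseteq> grid s e" "p \<noteq> q"
  obtains i where "i \<in> {1..s}" "(p, q) \<in> level_pairs s X i"
proof -
  define i where "i = (LEAST i. tail s i p = tail s i q)"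
  have "tail s s p = tail s s q" by (simp add: tail_eq_iff)
  then have i: "tail s i p = tail s i q" "i \<le> s"
    unfolding i_def by (auto intro: LeastI Least_le)
  have "i \<noteq> 0" using i(1) assms grid_tail_0_eq[of p s e q] by (metis subsetD)
  moreover from this have "i - 1 < i" by simp
  then have "tail s (i - 1) p \<noteq> tail s (i - 1) q" unfolding i_def by (rule not_less_Least)
  ultimately show ?thesis using i assms by (intro that[of i]) (auto simp: level_pairs_def)
qed

text \<open>Incidences between pairs of level \<open>i\<close> and blocks are counted twice. All
  such pairs lie in one orbit and hence in equally many blocks; all blocks are images of the
  standard grid and hence contain equally many such pairs. Both pair counts are counts in a grid,
  with sides \<open>e\<close> and \<open>x\<close> respectively.\<close>

lemma card_blocks_through_pair:
  fixes e x :: "nat \<Rightarrow> nat" and s :: nat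
  defines "\<B> \<equiv> block_orbit (wreath s e) (grid s x)"
  assumes x: "\<And>j. j \<in> {1..s} \<Longrightarrow> 0 < x j \<and> x j \<le> e j"
    and i: "i \<in> {1..s}" and pq: "(p, q) \<in> level_pairs s (grid s e) i"
  shows "card {X \<in> \<B>. p \<in> X \<and> q \<in> X} * ((\<Prod>j=1..s. e j) * ((e i - 1) * (\<Prod>j\<in>{1..<i}. e j)))
    = card \<B> * ((\<Prod>j=1..s. x j) * ((x i - 1) * (\<Prod>j\<in>{1..<i}. x j)))"
proof -
  let ?P = "grid s e" and ?B = "grid s x"
  let ?N = "\<lambda>p q. card {X \<in> \<B>. p \<in> X \<and> q \<in> X}"
  have \<B>: "\<B> = {X. regular s e x X}" unfolding \<B>_def by (rule block_orbit_eq_regular) (rule x)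
  have \<B>P: "X \<subseteq> ?P" if "X \<in> \<B>" for X using that by (auto simp: \<B> regular_def)
  have BP: "?B \<subseteq> ?P" using grid_mono[of s x e] x by auto
  have aut: "automorphism_group ?P \<B> (wreath s e)"
    unfolding \<B>_def by (rule automorphism_group_block_orbit[OF subgroup_wreath BP])
  have N: "?N p' q' = ?N (\<lambda>j\<in>{1..s}. 0) (\<lambda>j\<in>{1..s}. if j = i then 1 else 0)"
    if "(p', q') \<in> level_pairs s ?P i" for p' q'
  proof -
    have p'q': "p' \<in> ?P" "q' \<in> ?P" "tail s i p' = tail s i q'" "p' i \<noteq> q' i"
      using that tail_pred_iff[OF i, of p' q'] by (auto simp: level_pairs_def)
    obtain g where g: "g \<in> wreath s e" "g p' = (\<lambda>j\<in>{1..s}. 0)" "g q' = (\<lambda>j\<in>{1..s}. if j = i then 1 else 0)"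
      using pair_to_standard[OF p'q'(1,2) i p'q'(3,4)] .
    then show ?thesis
      using card_blocks_through_image[OF subgroup_wreath aut \<B>P g(1) p'q'(1,2)]
      unfolding g(2,3) by simp
  qed
  have fin: "finite (level_pairs s ?P i)"
    by (rule finite_subset[of _ "?P \<times> ?P"]) (auto simp: level_pairs_def finite_grid)
  have "?N p q * card (level_pairs s ?P i)
      = (\<Sum>pq\<in>level_pairs s ?P i. card {X \<in> \<B>. fst pq \<in> X \<and> snd pq \<in> X})"
  proof -
    have "card {X \<in> \<B>. fst r \<in> X \<and> snd r \<in> X} = ?N p q" if "r \<in> level_pairs s ?P i" for r
      using N[of "fst r" "snd r"] N[OF pq] that by simp
    then have "(\<Sum>r\<in>level_pairs s ?P i. card {X \<in> \<B>. fst r \<in> X \<and> snd r \<in> X})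
        = (\<Sum>r\<in>level_pairs s ?P i. ?N p q)" by (rule sum.cong[OF refl])
    then show ?thesis by simp
  qed
  also have "\<dots> = (\<Sum>X\<in>\<B>. card (level_pairs s ?B i))"
  proof (rule sum_multicount_gen[OF fin], unfold \<B>, rule finite_regular, fold \<B>, rule ballI)
    fix X assume X: "X \<in> \<B>"
    then obtain g where "g \<in> wreath s e" "X = g ` ?B" by (auto simp: \<B>_def block_orbit_def)
    then have "card (level_pairs s X i) = card (level_pairs s ?B i)"
      using card_level_pairs_image[OF _ BP, of g i] i by simp
    moreover have "{pq \<in> level_pairs s ?P i. fst pq \<in> X \<and> snd pq \<in> X} = level_pairs s X i"
      using \<B>P[OF X] by (auto simp: level_pairs_def)
    ultimately show "card {pq \<in> level_pairs s ?P i. fst pq \<in> X \<and> snd pq \<in> X} = card (level_pairs s ?B i)"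
      by simp
  qed
  finally show ?thesis by (simp add: card_level_pairs_grid[OF i])
qed

subsection \<open>Transitivity of the wreath product\<close>

lemma partition_chain_grid:
  assumes e: "\<And>j. j \<in> {1..s} \<Longrightarrow> 2 \<le> e j"
  shows "partition_chain (grid s e) s (grid_partition s e)"
  unfolding partition_chain_def
proof (intro conjI allI impI)
  let ?P = "grid s e"
  let ?z = "\<lambda>j\<in>{1..s}. 0::nat"
  have zP: "?z \<in> ?P" using e by (fastforce simp: grid_def)
  have "level_relation s e 0``{p} = {p}" if "p \<in> ?P" for p
    using that grid_tail_0_eq[of p s e] by (auto simp: level_relation_def)
  then show "grid_partition s e 0 = (\<lambda>p. {p}) ` ?P"
    by (auto simp: grid_partition_eq quotient_def)
  have "level_relation s e s``{p} = ?P" if "p \<in> ?P" for p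
    using that by (auto simp: level_relation_def tail_eq_iff)
  then show "grid_partition s e s = {?P}"
    using zP by (auto simp: grid_partition_eq quotient_def)
  fix i assume i: "i < s"
  have "\<exists>Y\<in>?P // level_relation s e (Suc i). X \<subseteq> Y" if X: "X \<in> ?P // level_relation s e i" for X
  proof -
    obtain p where p: "p \<in> ?P" "X = level_relation s e i``{p}" using X by (auto elim: quotientE)
    have "X \<subseteq> level_relation s e (Suc i)``{p}"
      unfolding p(2) by (auto simp: level_relation_def intro: tail_eq_mono[of i])
    then show ?thesis using quotientI[OF p(1)] by (rule bexI)
  qed
  then show "refines ?P (grid_partition s e i) (grid_partition s e (Suc i))"
    by (simp add: refines_def grid_partition_eq partition_on_quotient[OF equiv_level_relation])
  \<comment> \<open>Strict coarsening is witnessed by the zero point and its change in coordinate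
    \<open>Suc i\<close>, which is available because every side is at least 2.\<close>
  let ?w = "?z(Suc i := 1)"
  have wP: "?w \<in> ?P" using zP e[of "Suc i"] i by (auto simp: grid_def PiE_iff extensional_def)
  have lower: "(?z, ?w) \<notin> level_relation s e i" and upper: "(?z, ?w) \<in> level_relation s e (Suc i)"
    using i zP wP by (auto simp: level_relation_def tail_eq_iff)
  show "grid_partition s e i \<noteq> grid_partition s e (Suc i)"
  proof
    assume eq: "grid_partition s e i = grid_partition s e (Suc i)"
    have X: "level_relation s e (Suc i)``{?z} \<in> ?P // level_relation s e (Suc i)"
      using zP by (rule quotientI)
    then have X': "level_relation s e (Suc i)``{?z} \<in> ?P // level_relation s e i"
      using eq by (simp add: grid_partition_eq)
    have "?z \<in> level_relation s e (Suc i)``{?z}" "?w \<in> level_relation s e (Suc i)``{?z}"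
      using upper equiv_class_self[OF equiv_level_relation zP] by auto
    then show False using quotient_eq_iff[OF equiv_level_relation X' X'] lower by blast
  qed
qed

text \<open>The whole grid is regular with sides \<open>e\<close>, so any of its points can be moved
  to the zero point; two such moves are joined.\<close>

lemma wreath_transitive:
  assumes "p \<in> grid s e" "q \<in> grid s e"
  shows "\<exists>g\<in>wreath s e. g p = q"
proof -
  have e: "0 < e j \<and> e j \<le> e j" if "j \<in> {1..s}" for j
    using grid_apply_less[OF assms(1) that] by simp
  note std = regular_to_standard[OF regular_grid[OF e] _ e]
  obtain g h where "g \<in> wreath s e" "h \<in> wreath s e" "g p = h q"
    using std[OF _ assms(1)] std[OF _ assms(2)] by metis
  then show ?thesis using subgroup_connect[OF subgroup_wreath] assms by metis
qed

text \<open>Every flag can be moved to the standard flag formed by the zero point and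
  \<open>grid s x\<close>; joining two such moves connects any two flags.\<close>

lemma flag_transitive_wreath:
  assumes x: "\<And>j. j \<in> {1..s} \<Longrightarrow> 0 < x j \<and> x j \<le> e j"
  shows "flag_transitive (grid s e) (block_orbit (wreath s e) (grid s x)) (wreath s e)"
  unfolding flag_transitive_def
proof (intro conjI ballI)
  show "automorphism_group (grid s e) (block_orbit (wreath s e) (grid s x)) (wreath s e)"
    by (rule automorphism_group_block_orbit[OF subgroup_wreath]) (rule grid_mono, use x in blast)
  fix X p Y q
  assume "X \<in> block_orbit (wreath s e) (grid s x)" "Y \<in> block_orbit (wreath s e) (grid s x)"
    and pq: "p \<in> X" "q \<in> Y"
  then have X: "regular s e x X" and Y: "regular s e x Y"
    using block_orbit_eq_regular[of s x e] x by blast+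
  then have sub: "X \<subseteq> grid s e" "Y \<subseteq> grid s e" by (auto simp: regular_def)
  obtain g where g: "g \<in> wreath s e" "g ` X = grid s x" "g p = (\<lambda>j\<in>{1..s}. 0)"
    using regular_to_standard[OF X pq(1) x] by blast
  obtain h where h: "h \<in> wreath s e" "h ` Y = grid s x" "h q = (\<lambda>j\<in>{1..s}. 0)"
    using regular_to_standard[OF Y pq(2) x] by blast
  obtain f where "f \<in> wreath s e"
    and "\<And>z z'. z \<in> grid s e \<Longrightarrow> z' \<in> grid s e \<Longrightarrow> g z = h z' \<Longrightarrow> f z = z'"
    and "\<And>Z Z'. Z \<subseteq> grid s e \<Longrightarrow> Z' \<subseteq> grid s e \<Longrightarrow> g ` Z = h ` Z' \<Longrightarrow> f ` Z = Z'"
    using subgroup_connect[OF subgroup_wreath g(1) h(1)] by blast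
  moreover have "p \<in> grid s e" "q \<in> grid s e" using sub pq by blast+
  ultimately show "\<exists>f\<in>wreath s e. f p = q \<and> f ` X = Y"
    using g(2,3) h(2,3) sub by (intro bexI[of _ f] conjI) simp_all
qed

section \<open>Arithmetic of the parameters and assembly of the design\<close>

theorem proposition6p2:
  fixes s d v b :: nat
    and e :: "nat \<Rightarrow> nat"
    and k lam :: rat
    and y :: "nat \<Rightarrow> rat"
    and P B :: "(nat \<Rightarrow> nat) set"
    and \<B> :: "(nat \<Rightarrow> nat) set set"
    and G :: "((nat \<Rightarrow> nat) \<Rightarrow> nat \<Rightarrow> nat) set"
  assumes "s \<ge> 2" and "d \<ge> 2"
    and "e 1 = d + 1"
    and "\<And>i. 2 \<le> i \<Longrightarrow> i \<le> s \<Longrightarrow> e i = d + (\<Prod>j=1..i-1. e j)"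
    and "v = (\<Prod>j=1..s. e j)"
    and "k = 1 + (of_nat v - 1) / of_nat d"
    and "P = grid s e"
    and "G = wreath s e"
    and "y 0 = 1"
    and "\<And>i. 1 \<le> i \<Longrightarrow> i \<le> s \<Longrightarrow>
           y i = 1 + (k - 1) / (of_nat v - 1) * ((\<Prod>j=1..i. of_nat (e j)) - 1)"
    and "B = {\<delta> \<in> P. \<forall>i\<in>{1..s}. of_nat (\<delta> i) \<le> y i / y (i - 1) - 1}"
    and "\<B> = block_orbit G B"
    and "b = (\<Prod>i=1..s. (e i choose nat \<lfloor>y i / y (i - 1)\<rfloor>) ^ nat \<lfloor>k / y i\<rfloor>)"
    and "lam = of_nat b * k / (of_nat v * of_nat d)"
  shows "(\<exists>k' l'. k = of_nat k' \<and> lam = of_nat l' \<and> two_design P \<B> v k' l') \<and>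
         flag_transitive P \<B> G \<and>
         chain_imprimitive P \<B> G s (grid_partition s e) \<and>
         (\<forall>i\<in>{1..s}. y i / y (i - 1) \<in> \<nat> \<and> k / y i \<in> \<nat>) \<and>
         (\<forall>i\<in>{1..s-1}. y i = (of_nat (e (i + 1)) - 1) / of_nat d) \<and>
         y s = k"
proof -
  \<comment> \<open>\<open>x\<close> and \<open>Y\<close> are the natural-number values that
    \<open>y i / y (i - 1)\<close> and \<open>y i\<close> will turn out to have. The empty product
    gives \<open>E 0 = 1\<close>, which brings \<open>e 1 = d + 1\<close> under the same formula as
    the other sides.\<close>
  define E where "E i = (\<Prod>j=1..i. e j)" for i
  define x where "x i = E (i - 1) + 1" for i
  define Y where "Y i = (\<Prod>j=1..i. x j)" for i
  have e_eq: "e i = d + E (i - 1)" if "i \<in> {1..s}" for i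
    using assms(3,4) that by (cases "i = 1") (auto simp: E_def)
  have e2: "2 \<le> e i" if "i \<in> {1..s}" for i using e_eq[OF that] assms(2) by simp
  have x: "0 < x i \<and> x i \<le> e i" if "i \<in> {1..s}" for i
    using e_eq[OF that] assms(2) by (simp add: x_def)
  \<comment> \<open>This is Y_i = 1 + (E_i - 1)/d, cleared of division and subtraction. The
    induction step multiplies by \<open>E i + 1\<close> and uses
    \<open>E (Suc i) = E i * (d + E i)\<close>.\<close>
  have YE: "d * Y i + 1 = d + E i" if "i \<le> s" for i
    using that
  proof (induction i)
    case 0 then show ?case by (simp add: Y_def E_def)
  next
    case (Suc i)
    have E_Suc: "E (Suc i) = E i * (d + E i)" using Suc.prems e_eq[of "Suc i"] by (simp add: E_def)
    have "Y (Suc i) = Y i * (E i + 1)" by (simp add: Y_def x_def)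
    moreover have "d * Y i + 1 = d + E i" using Suc by simp
    moreover have "d * (Y i * (E i + 1)) + (E i + 1) = (d * Y i + 1) * (E i + 1)"
      by (simp add: algebra_simps)
    ultimately have "d * Y (Suc i) + (E i + 1) = (d + E i) * (E i + 1)" by simp
    then show ?case using E_Suc by (simp add: algebra_simps)
  qed
  have Epos: "0 < E i" if "i \<le> s" for i 
    unfolding E_def
  proof (rule prod_pos)
    fix j assume "j \<in> {1..i}"
    then show "0 < e j" using e2[of j] that by simp
  qed
  have Ypos: "0 < Y i" for i by (simp add: Y_def x_def prod_pos)
  have d0: "(of_nat d :: rat) \<noteq> 0" using assms(2) by simp
  have vE: "v = E s" using assms(5) by (simp add: E_def)
  have v2: "2 \<le> v"
  proof -
    have "{1..s} = insert s {1..s - 1}" using assms(1) by auto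
    then have "E s = e s * E (s - 1)" using assms(1) by (simp add: E_def)
    then show ?thesis using e2[of s] Epos[of "s - 1"] assms(1) vE by (cases "E (s - 1)") auto
  qed
  have YE': "of_nat (Y i) = 1 + (of_nat (E i) - 1) / (of_nat d :: rat)" if "i \<le> s" for i
  proof -
    have "of_nat d * of_nat (Y i) + 1 = (of_nat d + of_nat (E i) :: rat)"
      using arg_cong[OF YE[OF that], of "of_nat :: nat \<Rightarrow> rat"] by simp
    then show ?thesis using d0 by (simp add: field_simps)
  qed
  have k: "k = of_nat (Y s)" using YE'[of s] assms(6) vE by simp
  have y: "y i = of_nat (Y i)" if "i \<le> s" for i
  proof (cases "i = 0")
    case True
    then show ?thesis using assms(9) by (simp add: Y_def)
  next
    case False
    \<comment> \<open>Because \<open>v\<close> is not 1, the factor (k-1)/(v-1) cancels to 1/d, and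
      the formula for \<open>y i\<close> becomes the one for \<open>Y i\<close>.\<close>
    have "(of_nat v :: rat) \<noteq> 1" using v2 by simp
    then have "(k - 1) / (of_nat v - 1) = 1 / of_nat d" using assms(6) by simp
    then show ?thesis using assms(10)[of i] False that YE'[OF that] by (simp add: E_def)
  qed
  have y_ratio: "y i / y (i - 1) = of_nat (x i)" if "i \<in> {1..s}" for i
  proof -
    have "Y i = Y (i - 1) * x i" using that by (cases i) (auto simp: Y_def)
    moreover have "i \<le> s" "i - 1 \<le> s" using that by auto
    ultimately show ?thesis using y[of i] y[of "i - 1"] Ypos[of "i - 1"] by simp
  qed
  have k_ratio: "k / y i = of_nat (\<Prod>j\<in>{i<..s}. x j)" if "i \<le> s" for i
  proof -
    have "{1..s} = {1..i} \<union> {i<..s}" using that by auto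
    moreover have "prod x ({1..i} \<union> {i<..s}) = prod x {1..i} * prod x {i<..s}"
      by (rule prod.union_disjoint) auto
    ultimately have "Y s = Y i * (\<Prod>j\<in>{i<..s}. x j)" by (simp add: Y_def)
    then show ?thesis using k y[OF that] Ypos[of i] by simp
  qed
  have B: "B = grid s x"
  proof -
    have "of_nat (\<delta> i) \<le> y i / y (i - 1) - 1 \<longleftrightarrow> \<delta> i < x i" if "i \<in> {1..s}" for i and \<delta> :: "nat \<Rightarrow> nat"
    proof -
      \<comment> \<open>The rational bound is the integer \<open>E (i - 1)\<close>, so each
        coordinate of \<open>B\<close> ranges over exactly \<open>x i\<close> values.\<close>
      have "of_nat (\<delta> i) \<le> (of_nat (x i) - 1 :: rat) \<longleftrightarrow> \<delta> i \<le> E (i - 1)"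
        by (simp add: x_def)
      then show ?thesis using y_ratio[OF that] by (simp add: x_def less_Suc_eq_le)
    qed
    then have "B = {\<delta> \<in> grid s e. \<forall>i\<in>{1..s}. \<delta> i < x i}" using assms(7,11) by auto
    also have "\<dots> = grid s x" using x by (fastforce simp: grid_def PiE_iff)
    finally show ?thesis .
  qed
  have \<B>: "\<B> = block_orbit (wreath s e) (grid s x)" using assms(8,12) B by simp
  then have \<B>_reg: "\<B> = {X. regular s e x X}" using block_orbit_eq_regular[of s x e] x by simp
  \<comment> \<open>The two quotients in \<open>b\<close> are the integers \<open>x i\<close> and
    the product of the sides beyond \<open>i\<close>, so the floors change nothing and
    \<open>b\<close> is the count of regular sets.\<close>
  have b: "b = card \<B>"
  proof -
    have "card \<B> = (\<Prod>i=1..s. (e i choose x i) ^ (\<Prod>j\<in>{i<..s}. x j))"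
      unfolding \<B>_reg by (rule card_regular) (use x in blast)
    also have "\<dots> = b"
      unfolding assms(13)
    proof (rule prod.cong[OF refl])
      fix i assume i: "i \<in> {1..s}"
      then show "(e i choose x i) ^ (\<Prod>j\<in>{i<..s}. x j)
          = (e i choose nat \<lfloor>y i / y (i - 1)\<rfloor>) ^ nat \<lfloor>k / y i\<rfloor>"
        unfolding y_ratio[OF i] using k_ratio[of i] by (simp del: of_nat_prod)
    qed
    finally show ?thesis by simp
  qed
  have flag: "flag_transitive P \<B> G"
    using flag_transitive_wreath[of s x e] x assms(7,8) \<B> by simp
  have through: "card {X \<in> \<B>. p \<in> X \<and> q \<in> X} * (v * d) = b * Y s"
    if pq: "p \<in> P" "q \<in> P" "p \<noteq> q" for p q
  proof -
    obtain i where i: "i \<in> {1..s}" "(p, q) \<in> level_pairs s (grid s e) i"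
      using level_pairs_cover[OF pq(1,2) _ pq(3), of s e] assms(7) by auto
    have Y': "(\<Prod>j\<in>{1..<i}. x j) = Y (i - 1)" and E': "(\<Prod>j\<in>{1..<i}. e j) = E (i - 1)"
      using i(1) by (auto simp: Y_def E_def intro!: prod.cong)
    have i': "i - 1 \<le> s" using i(1) by auto
    \<comment> \<open>These two identities make the level-dependent factor
      \<open>Y (i - 1) * E (i - 1)\<close> common to both sides of the double count; cancelling it
      removes the dependence on \<open>i\<close>.\<close>
    have "e i - 1 = d * Y (i - 1)" using YE[OF i'] e_eq[OF i(1)] by simp
    moreover have "x i - 1 = E (i - 1)" by (simp add: x_def)
    ultimately have "card {X \<in> \<B>. p \<in> X \<and> q \<in> X} * (v * (d * Y (i - 1) * E (i - 1)))
        = b * (Y s * (E (i - 1) * Y (i - 1)))"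
      using card_blocks_through_pair[OF x i] Y' E' assms(5) b \<B> by (simp add: Y_def)
    then have "(card {X \<in> \<B>. p \<in> X \<and> q \<in> X} * (v * d)) * (Y (i - 1) * E (i - 1))
        = (b * Y s) * (Y (i - 1) * E (i - 1))" by (simp add: algebra_simps)
    then show ?thesis using Ypos[of "i - 1"] Epos[OF i'] by simp
  qed
  have cardP: "card P = v" "finite P" using assms(5,7) by (auto simp: card_grid finite_grid)
  \<comment> \<open>Any pair of distinct points may define the common value \<open>l\<close>, since
    \<open>through\<close> fixes its product with the positive number \<open>v * d\<close>.\<close>
  obtain p q where pq: "p \<in> P" "q \<in> P" "p \<noteq> q"
    using v2 cardP(1) card_le_Suc0_iff_eq[OF cardP(2)] by auto
  define l where "l = card {X \<in> \<B>. p \<in> X \<and> q \<in> X}"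
  have vd: "0 < v * d" using v2 assms(2) by simp
  have lam: "lam = of_nat l"
  proof -
    have eq: "of_nat l * (of_nat v * of_nat d) = of_nat b * k"
      using arg_cong[OF through[OF pq], of "of_nat :: nat \<Rightarrow> rat"] k by (simp add: l_def)
    have "(of_nat v * of_nat d :: rat) \<noteq> 0" using vd by simp
    then show ?thesis
      unfolding assms(14) eq[symmetric] by (rule nonzero_mult_div_cancel_right)
  qed
  have "two_design P \<B> v (Y s) l"
    unfolding two_design_def
  proof (intro conjI ballI impI cardP)
    show "\<B> \<noteq> {}"
      using regular_grid[of s x e] x by (auto simp: \<B>_reg)
    fix X assume X: "X \<in> \<B>"
    then show XP: "X \<subseteq> P" by (simp add: \<B>_reg regular_def assms(7))
    obtain g where g: "g \<in> wreath s e" "X = g ` grid s x" using X by (auto simp: \<B> block_orbit_def)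
    have "inj_on g (grid s e)" using g(1) by (auto simp: wreath_iff Bij_def bij_betw_def)
    then have "inj_on g (grid s x)" by (rule inj_on_subset) (rule grid_mono, use x in blast)
    then show "card X = Y s" by (simp add: g card_image card_grid Y_def)
  next
    fix p' q' assume "p' \<in> P" "q' \<in> P" "p' \<noteq> q'"
    then have "card {X \<in> \<B>. p' \<in> X \<and> q' \<in> X} * (v * d) = l * (v * d)"
      using through[OF pq] through[of p' q'] by (simp add: l_def)
    then show "card {X \<in> \<B>. p' \<in> X \<and> q' \<in> X} = l" using vd by simp
  qed
  moreover have "chain_imprimitive P \<B> G s (grid_partition s e)"
    unfolding chain_imprimitive_def
  proof (intro conjI)
    show "automorphism_group P \<B> G" using flag by (simp add: flag_transitive_def)
    show "\<forall>p\<in>P. \<forall>q\<in>P. \<exists>g\<in>G. g p = q" using wreath_transitive assms(7,8) by blast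
    show "partition_chain P s (grid_partition s e)"
      unfolding assms(7) by (rule partition_chain_grid) (rule e2)
    show "\<forall>g\<in>G. \<forall>i\<le>s. leaves_invariant g (grid_partition s e i)"
      by (simp add: assms(8) wreath_def chain_stabiliser_def)
  qed
  moreover have "\<forall>i\<in>{1..s}. y i / y (i - 1) \<in> \<nat> \<and> k / y i \<in> \<nat>"
  proof
    fix i assume i: "i \<in> {1..s}"
    then show "y i / y (i - 1) \<in> \<nat> \<and> k / y i \<in> \<nat>"
      unfolding y_ratio[OF i] using k_ratio[of i] by (simp del: of_nat_prod)
  qed
  moreover have "y i = (of_nat (e (i + 1)) - 1) / of_nat d" if "i \<in> {1..s-1}" for i
  proof -
    \<comment> \<open>Here \<open>e (i + 1) = d + E i\<close> turns 1 + (E_i - 1)/d into the stated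
      quotient.\<close>
    have "i \<le> s" "i + 1 \<in> {1..s}" using that by auto
    then show ?thesis using y[of i] YE'[of i] e_eq[of "i + 1"] d0 by (simp add: field_simps)
  qed
  moreover have "y s = k" using y[of s] k by simp
  ultimately show ?thesis using flag k lam by blast
qed

end
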